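(* For every real $R$ with $3/2\le R<2$ and every $\epsilon>0$, the competitive ratio of the general\&removable online knapsack problem with a buffer of capacity $R$ is at least $2-\epsilon$.
   Context: Online knapsack problem with a resource buffer: there is a knapsack of capacity $1$ and a buffer of capacity $R\ge 1$. Items $e_1,\dots,e_n$ arrive one by one; each item $e$ has size $0<s(e)\le 1$ and value $v(e)\ge 0$; $s(B),v(B)$ denote sums over a set $B$. A deterministic online algorithm maintains buffer contents $B_0=\emptyset,B_1,\dots,B_n$, with $B_i$ chosen after seeing only $e_1,\dots,e_i$, $B_i\subseteq B_{i-1}\cup\{e_i\}$ and $s(B_i)\le R$ (removable setting). $\mathrm{ALG}(I)=\max\{v(B)\mid B\subseteq B_n,\ s(B)\le 1\}$, $\mathrm{OPT}(I)=\max\{v(B)\mid B\subseteq\{e_1,\dots,e_n\},\ s(B)\le 1\}$. "General" means values are arbitrary. The competitive ratio of an algorithm is $\sup_I \mathrm{OPT}(I)/\mathrm{ALG}(I)$ (with $a/0=\infty$ for $a>0$), and the competitive ratio of the problem is the infimum of this over all deterministic online algorithms. *)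

theory Defs
  imports Complex_Main "HOL-Library.Extended_Real"
begin

datatype item = Item (item_size: real) (item_value: real)

text \<open>
  An instance is the list of items in order of arrival. Items are identified with their
  positions (counted from 0) in this list, so that different items may have the same size
  and value; sets of items are sets of positions.
\<close>

definition valid_instance :: "item list \<Rightarrow> bool" where
  "valid_instance I \<longleftrightarrow> (\<forall>e \<in> set I. 0 < item_size e \<and> item_size e \<le> 1 \<and> 0 \<le> item_value e)"

definition total_size :: "item list \<Rightarrow> nat set \<Rightarrow> real" where
  "total_size I B = (\<Sum>i\<in>B. item_size (I ! i))"

definition total_value :: "item list \<Rightarrow> nat set \<Rightarrow> real" where
  "total_value I B = (\<Sum>i\<in>B. item_value (I ! i))"

definition best_value :: "item list \<Rightarrow> nat set \<Rightarrow> real" where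
  "best_value I S = Max {total_value I B | B. B \<subseteq> S \<and> total_size I B \<le> 1}"

definition OPT :: "item list \<Rightarrow> real" where
  "OPT I = best_value I {..<length I}"

text \<open>
  A deterministic online algorithm is a function from the list of items seen so far to the
  buffer contents, so the buffer after the first \<open>i\<close> items cannot depend on later items or on
  the number of items still to come.
\<close>

type_synonym algorithm = "item list \<Rightarrow> nat set"

definition buffer :: "algorithm \<Rightarrow> item list \<Rightarrow> nat \<Rightarrow> nat set" where
  "buffer A I i = A (take i I)"

definition online_algorithm :: "real \<Rightarrow> algorithm \<Rightarrow> bool" where
  "online_algorithm R A \<longleftrightarrow>
     (\<forall>I. valid_instance I \<longrightarrow>
        buffer A I 0 = {} \<and>
        (\<forall>i < length I. buffer A I (Suc i) \<subseteq> buffer A I i \<union> {i}) \<and>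
        (\<forall>i \<le> length I. total_size I (buffer A I i) \<le> R))"

definition ALG :: "algorithm \<Rightarrow> item list \<Rightarrow> real" where
  "ALG A I = best_value I (buffer A I (length I))"

text \<open>
  Division in \<^typ>\<open>ereal\<close> gives \<open>a / 0 = \<infinity>\<close> for \<open>a > 0\<close>. It also gives \<open>0 / 0 = 0\<close>, so instances
  with optimal value 0 do not affect the supremum.
\<close>

definition algorithm_ratio :: "algorithm \<Rightarrow> ereal" where
  "algorithm_ratio A = (SUP I \<in> {I. valid_instance I}. ereal (OPT I) / ereal (ALG A I))"

definition competitive_ratio :: "real \<Rightarrow> ereal" where
  "competitive_ratio R = (INF A \<in> {A. online_algorithm R A}. algorithm_ratio A)"

end

theory Submission
  imports Defs
begin

text \<open>
  The adversary offers items whose sizes decrease from 1 but stay above \<open>R / 2\<close>, so that no two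
  of them fit into the buffer, and whose values decrease geometrically with a ratio \<open>q\<close> close to 1.
  If the algorithm keeps the old item instead of the new one of size \<open>s\<close>, the next and last item
  has size \<open>1 - s\<close> and the value of the old item: it fits together with the rejected item only, and
  the ratio is at least \<open>1 + q\<close>. If the algorithm always switches to the new item, it ends up with
  at most half the value of the first item.
\<close>

lemma finite_packing_values:
  assumes "finite S"
  shows "finite {total_value I B | B. B \<subseteq> S \<and> total_size I B \<le> 1}"
proof -
  have "{total_value I B | B. B \<subseteq> S \<and> total_size I B \<le> 1} \<subseteq> total_value I ` Pow S"
    by auto
  then show ?thesis
    using assms by (meson finite_Pow_iff finite_imageI finite_subset)
qed

lemma best_value_ge:
  assumes "finite S" "B \<subseteq> S" "total_size I B \<le> 1"
  shows "total_value I B \<le> best_value I S"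
  unfolding best_value_def
  by (rule Max_ge[OF finite_packing_values]) (use assms in auto)

lemma best_value_nonneg:
  assumes "finite S"
  shows "0 \<le> best_value I S"
  using best_value_ge[OF assms, of "{}" I] by (simp add: total_value_def total_size_def)

lemma best_value_le:
  assumes "finite S" "\<And>B. B \<subseteq> S \<Longrightarrow> total_size I B \<le> 1 \<Longrightarrow> total_value I B \<le> a"
  shows "best_value I S \<le> a"
proof -
  \<comment> \<open>The empty packing makes the set nonempty, as \<open>Max_le_iff\<close>
    requires.\<close>
  have "total_value I {} \<in> {total_value I B | B. B \<subseteq> S \<and> total_size I B \<le> 1}"
    by (auto simp: total_size_def intro!: exI[of _ "{}"])
  then show ?thesis
    unfolding best_value_def using assms
    by (subst Max_le_iff[OF finite_packing_values]) auto
qed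

text \<open>A positive bound \<open>a\<close> forces the optimum to be positive. Hence an algorithm
  that gains 0 has ratio infinity, and the default 0 / 0 = 0 cannot occur.\<close>

lemma algorithm_ratio_ge:
  assumes "valid_instance I" "finite (buffer A I (length I))"
    and "ALG A I \<le> a" "c * a \<le> OPT I" "0 < c" "0 < a"
  shows "ereal c \<le> algorithm_ratio A"
proof -
  have nonneg: "0 \<le> ALG A I"
    unfolding ALG_def using assms(2) by (rule best_value_nonneg)
  have pos: "0 < OPT I"
    using assms by (smt (verit) mult_pos_pos)
  have "ereal c \<le> ereal (OPT I) / ereal (ALG A I)"
  proof (cases "ALG A I = 0")
    case True
    then show ?thesis using pos by (simp add: divide_ereal_def)
  next
    case False
    have "c * ALG A I \<le> OPT I"
      using assms by (smt (verit) mult_left_mono)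
    then show ?thesis
      using False nonneg by (simp add: pos_le_divide_eq)
  qed
  also have "\<dots> \<le> algorithm_ratio A"
    unfolding algorithm_ratio_def using assms(1) by (intro SUP_upper) simp
  finally show ?thesis .
qed

lemma online_algorithm_Nil:
  assumes "online_algorithm R A"
  shows "A [] = {}"
  using assms unfolding online_algorithm_def
  by (auto simp: buffer_def valid_instance_def dest: spec[of _ "[]"])

lemma online_algorithm_snoc:
  assumes "online_algorithm R A" "valid_instance (I @ [e])"
  shows "A (I @ [e]) \<subseteq> A I \<union> {length I}"
  using assms unfolding online_algorithm_def
  by (auto simp: buffer_def dest!: spec[of _ "I @ [e]"] spec[of _ "length I"])

lemma online_algorithm_size:
  assumes "online_algorithm R A" "valid_instance I"
  shows "total_size I (A I) \<le> R"
  using assms unfolding online_algorithm_def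
  by (auto simp: buffer_def dest!: spec[of _ I] spec[of _ "length I"])

text \<open>The last two assumptions match the two ways in which the game ends:
  \<open>c * v k \<le> v k + v (Suc k)\<close> handles an algorithm that still holds item
  \<open>k\<close> after item \<open>Suc k\<close> has arrived, and \<open>c * v n \<le> v 0\<close>
  one for which this never happens.\<close>

lemma algorithm_ratio_of_decreasing_items:
  fixes s v :: "nat \<Rightarrow> real"
  assumes online: "online_algorithm R A"
    and s0: "s 0 = 1"
    and decr: "\<And>k. k < n \<Longrightarrow> s (Suc k) < s k"
    and big: "\<And>k. k \<le> n \<Longrightarrow> R / 2 < s k" "\<And>k. k \<le> n \<Longrightarrow> 0 < s k"
    and vpos: "\<And>k. 0 < v k"
    and c: "0 < c" "\<And>k. k < n \<Longrightarrow> c * v k \<le> v k + v (Suc k)" "c * v n \<le> v 0"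
  shows "ereal c \<le> algorithm_ratio A"
proof (rule ccontr)
  assume small: "\<not> ereal c \<le> algorithm_ratio A"
  define J where "J k = map (\<lambda>i. Item (s i) (v i)) [0..<k]" for k
  have len: "length (J k) = k" for k by (simp add: J_def)
  have nth: "J k ! i = Item (s i) (v i)" if "i < k" for i k
    using that by (simp add: J_def)
  have J_Suc: "J (Suc k) = J k @ [Item (s k) (v k)]" for k by (simp add: J_def)
  have s_le: "s k \<le> 1" if "k \<le> n" for k
    using that
  proof (induction k)
    case (Suc k)
    then show ?case using decr[of k] by simp
  qed (simp add: s0)
  have valid: "valid_instance (J k)" if "k \<le> Suc n" for k
    using that big(2) s_le less_imp_le[OF vpos] by (auto simp: valid_instance_def J_def)
  \<comment> \<open>Only an inclusion can be maintained, since the algorithm may also discard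
    everything.\<close>
  have track: "A (J (Suc k)) \<subseteq> {k}" if "k \<le> n" for k
    using that
  proof (induction k)
    case 0
    then show ?case
      using online_algorithm_snoc[OF online, of "J 0" "Item (s 0) (v 0)"] valid[of "Suc 0"]
        online_algorithm_Nil[OF online] by (simp add: J_def)
  next
    case (Suc k)
    have k: "k < n" using Suc.prems by simp
    have "A (J (Suc (Suc k))) \<subseteq> A (J (Suc k)) \<union> {Suc k}"
      using online_algorithm_snoc[OF online, of "J (Suc k)" "Item (s (Suc k)) (v (Suc k))"]
        valid[of "Suc (Suc k)"] k by (simp add: J_Suc[symmetric] len)
    then have sub: "A (J (Suc (Suc k))) \<subseteq> {k, Suc k}"
      using Suc.IH k by auto
    show ?case
    proof (rule ccontr)
      assume "\<not> ?case"
      then have old: "k \<in> A (J (Suc (Suc k)))" using sub by auto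
      have "A (J (Suc (Suc k))) \<noteq> {k, Suc k}"
      proof
        assume "A (J (Suc (Suc k))) = {k, Suc k}"
        then have "s k + s (Suc k) \<le> R"
          using online_algorithm_size[OF online valid[of "Suc (Suc k)"]] k
          by (simp add: total_size_def nth)
        then show False using big(1)[of k] big(1)[of "Suc k"] k by simp
      qed
      with sub old have keep: "A (J (Suc (Suc k))) = {k}" by auto
      \<comment> \<open>The new item has positive size because
        \<open>s (Suc k) < s k \<le> 1\<close>.\<close>
      define I where "I = J (Suc (Suc k)) @ [Item (1 - s (Suc k)) (v k)]"
      have lenI: "length I = Suc (Suc (Suc k))" by (simp add: I_def len)
      have nthI: "I ! k = Item (s k) (v k)" "I ! Suc k = Item (s (Suc k)) (v (Suc k))"
        "I ! Suc (Suc k) = Item (1 - s (Suc k)) (v k)"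
        using nth[of k "Suc (Suc k)"] nth[of "Suc k" "Suc (Suc k)"]
        by (auto simp: I_def nth_append len)
      have validI: "valid_instance I"
        using valid[of "Suc (Suc k)"] k decr[OF k] s_le[of k] big(2)[of "Suc k"] vpos[of k]
        by (simp add: I_def valid_instance_def ball_Un)
      \<comment> \<open>Item \<open>Suc k\<close> has already been given up and cannot be
        recovered.\<close>
      have bufI: "A I \<subseteq> {k, Suc (Suc k)}"
        using online_algorithm_snoc[OF online validI[unfolded I_def]] keep
        by (simp add: I_def len insert_commute)
      have buf: "buffer A I (length I) = A I" by (simp add: buffer_def)
      have fin: "finite (A I)" using bufI finite_subset by blast
      have "ALG A I \<le> v k"
        unfolding ALG_def buf
      proof (rule best_value_le[OF fin])
        fix B assume B: "B \<subseteq> A I" "total_size I B \<le> 1"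
        \<comment> \<open>Together these two items have size
          \<open>1 + s k - s (Suc k) > 1\<close>.\<close>
        have "B \<noteq> {k, Suc (Suc k)}"
          using B(2) decr[OF k] by (auto simp: total_size_def nthI)
        then have "B = {} \<or> B = {k} \<or> B = {Suc (Suc k)}"
          using B(1) bufI by blast
        then show "total_value I B \<le> v k"
          using vpos[of k] by (auto simp: total_value_def nthI)
      qed
      moreover have "c * v k \<le> OPT I"
      proof -
        \<comment> \<open>The last item was chosen to fill the knapsack exactly next to item
          \<open>Suc k\<close>.\<close>
        have "total_value I {Suc k, Suc (Suc k)} \<le> OPT I"
          unfolding OPT_def by (rule best_value_ge) (auto simp: lenI total_size_def nthI)
        then show ?thesis using c(2)[OF k] by (simp add: total_value_def nthI)
      qed
      ultimately show False
        using algorithm_ratio_ge[OF validI _ _ _ c(1) vpos[of k]] fin buf small by auto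
    qed
  qed
  have buf: "buffer A (J (Suc n)) (length (J (Suc n))) = A (J (Suc n))"
    by (simp add: buffer_def)
  have fin: "finite (A (J (Suc n)))" using track[of n] finite_subset by blast
  have "ALG A (J (Suc n)) \<le> v n"
    unfolding ALG_def buf
  proof (rule best_value_le[OF fin])
    fix B assume "B \<subseteq> A (J (Suc n))"
    then have "B = {} \<or> B = {n}" using track[of n] by blast
    then show "total_value (J (Suc n)) B \<le> v n"
      using vpos[of n] by (auto simp: total_value_def nth)
  qed
  moreover have "c * v n \<le> OPT (J (Suc n))"
  proof -
    have "total_value (J (Suc n)) {0} \<le> OPT (J (Suc n))"
      unfolding OPT_def by (rule best_value_ge) (auto simp: len total_size_def nth s0)
    then show ?thesis using c(3) by (simp add: total_value_def nth)
  qed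
  ultimately show False
    using algorithm_ratio_ge[OF valid[of "Suc n"] _ _ _ c(1) vpos[of n]] fin buf small by auto
qed

theorem theorem7:
  fixes R \<epsilon> :: real
  assumes "3 / 2 \<le> R" and "R < 2" and "\<epsilon> > 0"
  shows "competitive_ratio R \<ge> ereal (2 - \<epsilon>)"
  unfolding competitive_ratio_def
proof (rule INF_greatest)
  fix A assume "A \<in> {A. online_algorithm R A}"
  then have online: "online_algorithm R A" by simp
  \<comment> \<open>The minimum keeps \<open>q\<close> positive when \<epsilon> is large.\<close>
  define q where "q = 1 - min \<epsilon> (1 / 2)"
  have q: "0 < q" "q < 1" "2 - \<epsilon> \<le> 1 + q"
    using assms(3) by (auto simp: q_def)
  obtain n where n: "q ^ n < 1 / 2"
    using real_arch_pow_inv[of "1 / 2" q] q by auto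
  \<comment> \<open>Dividing by \<open>n + 1\<close> rather than \<open>n\<close> keeps the size
    strictly above \<open>R / 2\<close> even after \<open>n\<close> decrements.\<close>
  define d where "d = (1 - R / 2) / (real n + 1)"
  have d: "0 < d" "(real n + 1) * d = 1 - R / 2"
    using assms(2) by (auto simp: d_def)
  have size: "R / 2 < 1 - real k * d" if "k \<le> n" for k
  proof -
    have "real k * d < (real n + 1) * d"
      using that d(1) by (intro mult_strict_right_mono) auto
    then show ?thesis using d(2) by simp
  qed
  have "ereal (1 + q) \<le> algorithm_ratio A"
  proof (rule algorithm_ratio_of_decreasing_items[OF online,
        where s = "\<lambda>k. 1 - real k * d" and v = "\<lambda>k. q ^ k" and n = n])
    show "0 < 1 - real k * d" if "k \<le> n" for k
      using size[OF that] assms(1) by simp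
    have "(1 + q) * q ^ n \<le> 2 * (1 / 2)"
      using q n by (intro mult_mono) auto
    then show "(1 + q) * q ^ n \<le> q ^ 0" by simp
  \<comment> \<open>For \<open>v k = q ^ k\<close> and \<open>c = 1 + q\<close>, the condition for a
    kept item holds with equality.\<close>
  qed (use d(1) q size in \<open>auto simp: algebra_simps\<close>)
  then show "ereal (2 - \<epsilon>) \<le> algorithm_ratio A"
    using q(3) by (meson ereal_less_eq(3) order_trans)
qed

end
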